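(* Let $\mathcal{F}_{ractal}$ be the set of all graph fractaloids induced by connected locally finite directed graphs. Then $\mathcal{F}_{ractal}$ is classified by the spectral classes $[(n,m)]$, $(n,m)\in\mathbb{N}\times\mathbb{N}_\infty$; that is, $$\mathcal{F}_{ractal}=\bigsqcup_{(n,m)\in\mathbb{N}\times\mathbb{N}_\infty}[(n,m)],$$ where $\sqcup$ means the disjoint union.
   Context: $\mathbb{N}=\{1,2,\dots\}$, $\mathbb{N}_\infty=\mathbb{N}\cup\{\infty\}$. Graphs are countable directed graphs $G=(V(G),E(G))$; loops and multiple edges are allowed. $\deg_{out}(v)$ (resp. $\deg_{in}(v)$) is the number of edges with initial (resp. terminal) vertex $v$; $G$ is locally finite if all $\deg_{out}(v)+\deg_{in}(v)$ are finite. Shadowed graph: for each edge $e$ from $v_1$ to $v_2$ introduce its shadow $e^{-1}$ from $v_2$ to $v_1$; $\widehat{G}$ is the directed graph with $V(\widehat G)=V(G)$ and $E(\widehat G)=E(G)\sqcup\{e^{-1}:e\in E(G)\}$. Graph groupoid: $\mathbb{G}$ consists of the vertices of $\widehat G$ (the units), all reduced finite paths in $\widehat G$ (reduction: $ww^{-1}=v$ and $w^{-1}w=v'$ for a path $w$ from $v$ to $v'$), and an empty element $\emptyset$ standing for non-composable products; the product is concatenation followed by reduction. Fractal graph: a connected locally finite directed graph $G$ is a fractal graph if the out-degrees and in-degrees of all its vertices are identical, i.e. there is $N\in\mathbb{N}$ with $\deg_{out}(v)=N=\deg_{in}(v)$ for all $v\in V(G)$; then $\mathbb{G}$ is called the graph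 fractaloid of $G$. Its fractal pair is $fp(\mathbb{G})=(N_0,N^0)$ with $N_0=\max\{\deg_{out}(v):v\in V(G)\}\in\mathbb{N}$ and $N^0=|V(G)|\in\mathbb{N}_\infty$. $\mathcal{F}_{ractal}$ is the collection of all graph fractaloids of connected locally finite fractal graphs. The spectral relation on it is $\mathbb{G}_1\,\mathcal{R}\,\mathbb{G}_2\iff fp(\mathbb{G}_1)=fp(\mathbb{G}_2)$; its equivalence classes, the spectral classes, are $[(n,m)]=\{\mathbb{G}\in\mathcal{F}_{ractal}: fp(\mathbb{G})=(n,m)\}$. *)

theory Defs
  imports
    "Graph_Theory.Graph_Theory"
    "HOL-Library.Extended_Nat"
    "HOL-Library.Countable_Set"
    "HOL-Library.Disjoint_Sets"
    "HOL-Library.Infinite_Typeclass"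
begin

section \<open>Shadowed graphs and reduction of paths\<close>

datatype 'e sedge = Edge 'e | Shadow 'e

primrec edge_inverse :: "'e sedge \<Rightarrow> 'e sedge" where
  "edge_inverse (Edge e) = Shadow e"
| "edge_inverse (Shadow e) = Edge e"

definition path_inverse :: "'e sedge list \<Rightarrow> 'e sedge list" where
  "path_inverse w = rev (map edge_inverse w)"

definition shadowed_graph :: "('v, 'e) pre_digraph \<Rightarrow> ('v, 'e sedge) pre_digraph" where
  "shadowed_graph G = \<lparr>
     verts = verts G,
     arcs = Edge ` arcs G \<union> Shadow ` arcs G,
     tail = case_sedge (tail G) (head G),
     head = case_sedge (head G) (tail G) \<rparr>"

definition reduced :: "'e sedge list \<Rightarrow> bool" where
  "reduced p \<longleftrightarrow> \<not> (\<exists>x w y. w \<noteq> [] \<and> p = x @ w @ path_inverse w @ y)"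

text \<open>
  The reduced form of a path. Deleting a factor \<open>w w\<^sup>-\<^sup>1\<close> amounts to deleting factors
  \<open>e e\<^sup>-\<^sup>1\<close> one after the other, so it is enough to cancel single edges; the lemmas
  \<open>reduce_cancel\<close>, \<open>reduced_reduce\<close> and \<open>reduce_reduced\<close> below justify this.
\<close>

fun cancel_cons :: "'e sedge \<Rightarrow> 'e sedge list \<Rightarrow> 'e sedge list" where
  "cancel_cons e [] = [e]"
| "cancel_cons e (f # p) = (if f = edge_inverse e then p else e # f # p)"

definition reduce :: "'e sedge list \<Rightarrow> 'e sedge list" where
  "reduce p = foldr cancel_cons p []"

lemma edge_inverse_inverse [simp]: "edge_inverse (edge_inverse e) = e"
  by (cases e) auto

lemma edge_inverse_eq_iff [simp]: "edge_inverse e = edge_inverse f \<longleftrightarrow> e = f"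
  by (metis edge_inverse_inverse)

lemma reduce_Nil [simp]: "reduce [] = []"
  and reduce_Cons [simp]: "reduce (e # p) = cancel_cons e (reduce p)"
  by (simp_all add: reduce_def)

lemma reduced_iff: "reduced p \<longleftrightarrow> (\<nexists>x e y. p = x @ e # edge_inverse e # y)"
proof
  assume r: "reduced p"
  show "\<nexists>x e y. p = x @ e # edge_inverse e # y"
  proof safe
    fix x e y
    assume "p = x @ e # edge_inverse e # y"
    then have "p = x @ [e] @ path_inverse [e] @ y" by (simp add: path_inverse_def)
    with r show False unfolding reduced_def by blast
  qed
next
  assume r: "\<nexists>x e y. p = x @ e # edge_inverse e # y"
  show "reduced p"
    unfolding reduced_def
  proof safe
    fix x w y
    assume p: "p = x @ w @ path_inverse w @ y" and "w \<noteq> []"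
    then obtain w' e where "w = w' @ [e]" by (metis rev_exhaust)
    with p have "p = (x @ w') @ e # edge_inverse e # (path_inverse w' @ y)"
      by (simp add: path_inverse_def)
    with r show False by blast
  qed
qed

lemma reduced_Cons_iff:
  "reduced (e # p) \<longleftrightarrow> reduced p \<and> (\<forall>f q. p = f # q \<longrightarrow> f \<noteq> edge_inverse e)"
  unfolding reduced_iff
  by (auto simp: Cons_eq_append_conv)

lemma reduced_Nil [simp]: "reduced []"
  by (simp add: reduced_def)

lemma reduced_cancel_cons: "reduced p \<Longrightarrow> reduced (cancel_cons e p)"
  by (cases p) (auto simp: reduced_Cons_iff)

lemma reduced_reduce: "reduced (reduce p)"
  by (induction p) (simp_all add: reduced_cancel_cons)

lemma reduce_reduced: "reduced p \<Longrightarrow> reduce p = p"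
proof (induction p)
  case (Cons e p)
  then show ?case by (cases p) (auto simp: reduced_Cons_iff)
qed simp

lemma cancel_cons_inverse:
  assumes "reduced p"
  shows "cancel_cons e (cancel_cons (edge_inverse e) p) = p"
proof (cases p)
  case (Cons f q)
  with assms show ?thesis by (cases q) (auto simp: reduced_Cons_iff)
qed simp

lemma reduce_cancel: "reduce (x @ w @ path_inverse w @ y) = reduce (x @ y)"
proof -
  have w: "reduce (w @ path_inverse w @ y) = reduce y" for y
  proof (induction w arbitrary: y)
    case (Cons e w)
    from Cons[of "edge_inverse e # y"] show ?case
      by (simp add: path_inverse_def cancel_cons_inverse reduced_reduce)
  qed (simp add: path_inverse_def)
  show ?thesis by (induction x) (simp_all add: w)
qed


section \<open>Graph groupoids\<close>

datatype ('v, 'e) gelem = Vertex 'v | Path "'e sedge list" | Empty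

record ('v, 'e) graph_groupoid =
  elements :: "('v, 'e) gelem set"
  product :: "('v, 'e) gelem \<Rightarrow> ('v, 'e) gelem \<Rightarrow> ('v, 'e) gelem"

definition groupoid_elements :: "('v, 'e) pre_digraph \<Rightarrow> ('v, 'e) gelem set" where
  "groupoid_elements G =
     Vertex ` verts (shadowed_graph G) \<union>
     {Path p | p. p \<noteq> [] \<and> (\<exists>u v. pre_digraph.awalk (shadowed_graph G) u p v) \<and> reduced p} \<union>
     {Empty}"

fun groupoid_product ::
  "('v, 'e) pre_digraph \<Rightarrow> ('v, 'e) gelem \<Rightarrow> ('v, 'e) gelem \<Rightarrow> ('v, 'e) gelem" where
  "groupoid_product G (Vertex u) (Vertex v) = (if u = v then Vertex u else Empty)"
| "groupoid_product G (Vertex u) (Path p) =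
     (if u = tail (shadowed_graph G) (hd p) then Path p else Empty)"
| "groupoid_product G (Path p) (Vertex v) =
     (if head (shadowed_graph G) (last p) = v then Path p else Empty)"
| "groupoid_product G (Path p) (Path q) =
     (if head (shadowed_graph G) (last p) = tail (shadowed_graph G) (hd q)
      then if reduce (p @ q) = [] then Vertex (tail (shadowed_graph G) (hd p))
           else Path (reduce (p @ q))
      else Empty)"
| "groupoid_product G _ _ = Empty"

text \<open>
  Outside the set of elements the product is set to \<open>Empty\<close>, so that equality of groupoids does
  not depend on values of \<open>tail\<close> and \<open>head\<close> at non-edges.
\<close>

definition groupoid_of :: "('v, 'e) pre_digraph \<Rightarrow> ('v, 'e) graph_groupoid" where
  "groupoid_of G = \<lparr>
     elements = groupoid_elements G,
     product = (\<lambda>x y. if x \<in> groupoid_elements G \<and> y \<in> groupoid_elements G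
                      then groupoid_product G x y else Empty) \<rparr>"


section \<open>Fractal graphs, fractaloids and the fractal pair\<close>

definition locally_finite :: "('v, 'e) pre_digraph \<Rightarrow> bool" where
  "locally_finite G \<longleftrightarrow> (\<forall>v \<in> verts G. finite (out_arcs G v) \<and> finite (in_arcs G v))"

text \<open>
  Connectedness is that of the underlying undirected multigraph, i.e. any two vertices are joined
  by a path of the shadowed graph; it excludes the null graph. (The qualified name avoids the
  topological constant of the same name.)
\<close>

definition fractal_graph :: "('v, 'e) pre_digraph \<Rightarrow> bool" where
  "fractal_graph G \<longleftrightarrow>
     wf_digraph G \<and> countable (verts G) \<and> countable (arcs G) \<and>
     Digraph_Component.connected G \<and> locally_finite G \<and>
     (\<exists>N \<ge> 1. \<forall>v \<in> verts G. out_degree G v = N \<and> in_degree G v = N)"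

definition fractaloids :: "('v, 'e) graph_groupoid set" where
  "fractaloids = {groupoid_of G | G. fractal_graph G}"

definition max_out_degree :: "('v, 'e) pre_digraph \<Rightarrow> nat" where
  "max_out_degree G = Max (out_degree G ` verts G)"

definition vertex_count :: "('v, 'e) pre_digraph \<Rightarrow> enat" where
  "vertex_count G = (if finite (verts G) then enat (card (verts G)) else \<infinity>)"

text \<open>
  The pair is read off from any fractal graph inducing the groupoid; the result does not depend on
  the choice, see \<open>fractal_pair_groupoid_of\<close>.
\<close>

definition fractal_pair :: "('v, 'e) graph_groupoid \<Rightarrow> nat \<times> enat" where
  "fractal_pair \<G> =
     (THE fp. \<exists>G. fractal_graph G \<and> groupoid_of G = \<G> \<and> fp = (max_out_degree G, vertex_count G))"

definition spectral_relation :: "(('v, 'e) graph_groupoid \<times> ('v, 'e) graph_groupoid) set" where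
  "spectral_relation =
     {(\<G>\<^sub>1, \<G>\<^sub>2). \<G>\<^sub>1 \<in> fractaloids \<and> \<G>\<^sub>2 \<in> fractaloids \<and> fractal_pair \<G>\<^sub>1 = fractal_pair \<G>\<^sub>2}"

definition spectral_class :: "nat \<times> enat \<Rightarrow> ('v, 'e) graph_groupoid set" where
  "spectral_class nm = {\<G> \<in> fractaloids. fractal_pair \<G> = nm}"

lemma Vertex_in_elements [simp]: "Vertex v \<in> groupoid_elements G \<longleftrightarrow> v \<in> verts G"
  by (auto simp: groupoid_elements_def shadowed_graph_def)

lemma Path_Edge_in_elements:
  assumes "wf_digraph G"
  shows "Path [Edge e] \<in> groupoid_elements G \<longleftrightarrow> e \<in> arcs G"
proof -
  have "(\<exists>u v. pre_digraph.awalk (shadowed_graph G) u [Edge e] v) \<longleftrightarrow> e \<in> arcs G"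
    using wf_digraph.tail_in_verts[OF assms]
    unfolding pre_digraph.awalk_def pre_digraph.cas.simps
    by (auto simp: shadowed_graph_def)
  then show ?thesis by (auto simp: groupoid_elements_def reduced_Cons_iff)
qed

lemma groupoid_of_inject:
  assumes "wf_digraph G" "wf_digraph H" and eq: "groupoid_of G = groupoid_of H"
  shows "verts G = verts H" "\<And>v. out_arcs G v = out_arcs H v"
proof -
  have el: "groupoid_elements G = groupoid_elements H"
    using arg_cong[OF eq, of elements] by (simp add: groupoid_of_def)
  have pr: "groupoid_product G x y = groupoid_product H x y"
    if "x \<in> groupoid_elements G" "y \<in> groupoid_elements G" for x y
    using arg_cong[OF eq, of "\<lambda>\<G>. product \<G> x y"] that el by (simp add: groupoid_of_def)
  show V: "verts G = verts H"
  proof (rule set_eqI)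
    fix v show "v \<in> verts G \<longleftrightarrow> v \<in> verts H"
      using el Vertex_in_elements[of v G] Vertex_in_elements[of v H] by simp
  qed
  have A: "arcs G = arcs H" 
    using el Path_Edge_in_elements[OF assms(1)] Path_Edge_in_elements[OF assms(2)] by auto
  have "tail G e = tail H e" if "e \<in> arcs G" for e
  proof -
    have t: "tail G e \<in> verts G" using assms(1) that by (simp add: wf_digraph.tail_in_verts)
    have "groupoid_product G (Vertex (tail G e)) (Path [Edge e]) =
        groupoid_product H (Vertex (tail G e)) (Path [Edge e])"
      by (rule pr) (simp_all add: t that Path_Edge_in_elements[OF assms(1)])
    then show ?thesis by (simp add: shadowed_graph_def split: if_splits)
  qed
  then show "out_arcs G v = out_arcs H v" for v using A by (auto simp: out_arcs_def)
qed

lemma fractal_pair_groupoid_of: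
  assumes "fractal_graph G"
  shows "fractal_pair (groupoid_of G) = (max_out_degree G, vertex_count G)"
proof -
  have "max_out_degree H = max_out_degree G \<and> vertex_count H = vertex_count G"
    if H: "fractal_graph H" "groupoid_of H = groupoid_of G" for H :: "('a, 'b) pre_digraph"
  proof -
    have "wf_digraph H" "wf_digraph G" using H(1) assms by (simp_all add: fractal_graph_def)
    note inj = groupoid_of_inject[OF this H(2)]
    have "out_degree H = out_degree G" by (rule ext) (simp add: out_degree_def inj(2))
    with inj(1) show ?thesis by (simp add: max_out_degree_def vertex_count_def)
  qed
  with assms show ?thesis unfolding fractal_pair_def by (intro the_equality) blast+
qed

end

theory Submission
  imports Defs
begin

text \<open>
  The partition and the equivalence relation are formal, since the spectral relation is the kernel
  of the fractal pair. What has to be shown is that every pair \<open>(n, m)\<close> is attained: replace each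
  edge of a directed cycle of length \<open>m\<close>, or of the two-sided infinite directed line if
  \<open>m = \<infinity>\<close>, by \<open>n\<close> parallel edges.
\<close>

text \<open>
  Vertices and edges must come from the given types; \<open>f\<close> and \<open>g\<close> embed the index set \<open>I\<close> and
  the parallel edges from \<open>i\<close> to \<open>s i\<close>, numbered by \<open>k < N\<close>, into them.
\<close>

definition functional_graph ::
  "('i \<Rightarrow> 'v) \<Rightarrow> ('i \<times> nat \<Rightarrow> 'e) \<Rightarrow> 'i set \<Rightarrow> ('i \<Rightarrow> 'i) \<Rightarrow> nat \<Rightarrow> ('v, 'e) pre_digraph" where
  "functional_graph f g I s N = \<lparr>
     verts = f ` I,
     arcs = g ` (I \<times> {..<N}),
     tail = (\<lambda>e. f (fst (inv g e))),
     head = (\<lambda>e. f (s (fst (inv g e)))) \<rparr>"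

lemma wf_digraph_functional_graph:
  assumes "inj g" "s ` I \<subseteq> I"
  shows "wf_digraph (functional_graph f g I s N)"
  using assms by unfold_locales (auto simp: functional_graph_def)

lemma out_arcs_functional_graph:
  assumes "inj f" "inj g" "i \<in> I"
  shows "out_arcs (functional_graph f g I s N) (f i) = g ` ({i} \<times> {..<N})"
  using assms by (auto simp: functional_graph_def out_arcs_def inj_eq)

text \<open>Injectivity of \<open>s\<close> on \<open>I\<close> leaves only the bundle that starts
  at \<open>i\<close> to end at \<open>f (s i)\<close>. Naming the vertex as an image under
  \<open>s\<close> avoids an inverse of \<open>s\<close>.\<close>

lemma in_arcs_functional_graph:
  assumes "inj f" "inj g" "inj_on s I" "i \<in> I"
  shows "in_arcs (functional_graph f g I s N) (f (s i)) = g ` ({i} \<times> {..<N})"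
  using assms by (auto simp: functional_graph_def in_arcs_def inj_eq dest: inj_onD)

lemma connected_functional_graph:
  assumes "inj g" "s ` I \<subseteq> I" "N \<ge> 1" "I \<noteq> {}"
    and orbit: "\<And>i j. i \<in> I \<Longrightarrow> j \<in> I \<Longrightarrow> \<exists>k. (s ^^ k) i = j \<or> (s ^^ k) j = i"
  shows "Digraph_Component.connected (functional_graph f g I s N)"
proof -
  let ?G = "functional_graph f g I s N"
  interpret wf_digraph ?G using assms(1,2) by (rule wf_digraph_functional_graph)
  have step: "f i \<rightarrow>\<^bsub>?G\<^esub> f (s i)" if "i \<in> I" for i
  proof (rule dominatesI)
    show "arc_to_ends ?G (g (i, 0)) = (f i, f (s i))"
      using \<open>inj g\<close> by (simp add: functional_graph_def arc_to_ends_def)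
    \<comment> \<open>Edge number 0 of each bundle exists because \<open>N \<ge> 1\<close>.\<close>
    show "g (i, 0) \<in> arcs ?G" using that \<open>N \<ge> 1\<close> by (auto simp: functional_graph_def)
  qed
  have "(s ^^ k) i \<in> I \<and> f i \<rightarrow>\<^sup>*\<^bsub>?G\<^esub> f ((s ^^ k) i)" if "i \<in> I" for i k
  proof (induction k)
    case 0
    have "f i \<in> verts ?G" using that by (simp add: functional_graph_def)
    then show ?case using that by simp
  next
    case (Suc k)
    then show ?case using step assms(2) by (auto intro: reachable_adj_trans)
  qed
  \<comment> \<open>An orbit gives a directed path in only one of the two directions; symmetrization
    lets it be traversed backwards.\<close>
  then have "f i \<rightarrow>\<^sup>*\<^bsub>mk_symmetric ?G\<^esub> f j" if "i \<in> I" "j \<in> I" for i j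
    using that orbit[of i j] symmetric_reachable[OF symmetric_mk_symmetric]
    by (metis reachable_mk_symmetricI)
  then show ?thesis
    using \<open>I \<noteq> {}\<close> unfolding connected_def
    by (intro strongly_connectedI) (auto simp: functional_graph_def)
qed

lemma fractal_functional_graph:
  fixes f :: "'i :: countable \<Rightarrow> 'v"
  assumes "inj f" "inj g" and s: "bij_betw s I I" and "N \<ge> 1" "I \<noteq> {}"
    and orbit: "\<And>i j. i \<in> I \<Longrightarrow> j \<in> I \<Longrightarrow> \<exists>k. (s ^^ k) i = j \<or> (s ^^ k) j = i"
  defines "G \<equiv> functional_graph f g I s N"
  shows "fractal_graph G" "max_out_degree G = N"
    "vertex_count G = (if finite I then enat (card I) else \<infinity>)"
proof -
  have sI: "s ` I = I" and inj: "inj_on s I" using s by (auto simp: bij_betw_def)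
  have V: "verts G = f ` I" by (simp add: G_def functional_graph_def)
  have arcs_at: "card (g ` ({i} \<times> {..<N})) = N" for i
    using \<open>inj g\<close> by (simp add: card_image inj_on_subset[OF \<open>inj g\<close>] card_cartesian_product)
  have out: "finite (out_arcs G v) \<and> out_degree G v = N" if "v \<in> verts G" for v
    using that arcs_at unfolding V
    by (auto simp: G_def out_degree_def out_arcs_functional_graph assms(1,2))
  have ins: "finite (in_arcs G v) \<and> in_degree G v = N" if v: "v \<in> verts G" for v
  proof -
    \<comment> \<open>Surjectivity of \<open>s\<close> on \<open>I\<close> supplies the predecessor
      whose bundle enters \<open>v\<close>.\<close>
    from v have "v \<in> f ` s ` I" by (simp add: V sI)
    then obtain i where "i \<in> I" "v = f (s i)" by blast
    then show ?thesis
      using arcs_at by (simp add: G_def in_degree_def in_arcs_functional_graph assms(1,2) inj)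
  qed
  have "wf_digraph G" unfolding G_def using \<open>inj g\<close> sI by (intro wf_digraph_functional_graph) auto
  moreover have "Digraph_Component.connected G"
    unfolding G_def
    by (rule connected_functional_graph[OF \<open>inj g\<close> equalityD1[OF sI] \<open>N \<ge> 1\<close> \<open>I \<noteq> {}\<close> orbit])
  moreover have "countable (verts G)" "countable (arcs G)"
    by (simp_all add: G_def functional_graph_def)
  ultimately show "fractal_graph G"
    using out ins \<open>N \<ge> 1\<close> unfolding fractal_graph_def locally_finite_def by blast
  have "out_degree G ` verts G = {N}" using out \<open>I \<noteq> {}\<close> by (auto simp: V)
  then show "max_out_degree G = N" by (simp add: max_out_degree_def)
  show "vertex_count G = (if finite I then enat (card I) else \<infinity>)"
    using \<open>inj f\<close>
    by (simp add: vertex_count_def V finite_image_iff card_image inj_on_subset[OF \<open>inj f\<close>])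
qed

lemma ex_inj_infinite: "\<exists>f :: 'i :: countable \<Rightarrow> 'a :: infinite. inj f"
proof -
  obtain h :: "nat \<Rightarrow> 'a" where "inj h"
    using infinite_countable_subset[OF infinite_UNIV] by blast
  then have "inj (h \<circ> (to_nat :: 'i \<Rightarrow> nat))" by (intro inj_compose) auto
  then show ?thesis by blast
qed

text \<open>The cycle and the line are both indexed by integers, so one pair of embeddings of
  vertices and edges serves finite and infinite \<open>m\<close>.\<close>

lemma ex_transitive_permutation:
  fixes m :: enat
  assumes "m \<ge> 1"
  shows "\<exists>(I :: int set) s. I \<noteq> {} \<and> bij_betw s I I \<and>
           (\<forall>i \<in> I. \<forall>j \<in> I. \<exists>k. (s ^^ k) i = j \<or> (s ^^ k) j = i) \<and>
           m = (if finite I then enat (card I) else \<infinity>)"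
proof (cases m)
  case (enat c)
  with assms have c: "c \<ge> 1" by (simp add: one_enat_def)
  define I where "I = {0..<int c}"
  \<comment> \<open>For \<open>c = 1\<close> this is the identity on \<open>{0}\<close>, so the
    cycle degenerates to loops at one vertex.\<close>
  define s where "s i = (i + 1) mod int c" for i
  have "bij_betw s I I"
    by (rule bij_betwI[where g = "\<lambda>i. (i - 1) mod int c"])
      (use c in \<open>auto simp: I_def s_def mod_diff_left_eq mod_add_left_eq\<close>)
  \<comment> \<open>The restriction to \<open>I\<close> matters at \<open>k = 0\<close>, where
    \<open>i mod int c = i\<close> is required.\<close>
  moreover have pow: "(s ^^ k) i = (i + int k) mod int c" if "i \<in> I" for i k
    using that by (induction k) (auto simp: I_def s_def mod_add_left_eq ac_simps mod_add_right_eq)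
  have "\<exists>k. (s ^^ k) i = j" if "i \<in> I" "j \<in> I" "i \<le> j" for i j
    using that by (intro exI[of _ "nat (j - i)"]) (auto simp: pow, simp add: I_def)
  then have "\<forall>i \<in> I. \<forall>j \<in> I. \<exists>k. (s ^^ k) i = j \<or> (s ^^ k) j = i" by (meson linear)
  moreover have "I \<noteq> {}" "m = (if finite I then enat (card I) else \<infinity>)"
    using c enat by (simp_all add: I_def)
  ultimately show ?thesis by blast
next
  case infinity
  define s where "s i = i + 1" for i :: int
  \<comment> \<open>Here the index set is \<open>UNIV\<close>. The line is infinite in both
    directions, since each vertex needs incoming edges as well.\<close>
  have "bij s" by (rule bij_betwI[where g = "\<lambda>i. i - 1"]) (auto simp: s_def)
  moreover have pow: "(s ^^ k) i = i + int k" for i k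
    by (induction k) (auto simp: s_def)
  have "\<exists>k. (s ^^ k) i = j" if "i \<le> j" for i j
    using that by (intro exI[of _ "nat (j - i)"]) (simp add: pow)
  then have "\<forall>i j. \<exists>k. (s ^^ k) i = j \<or> (s ^^ k) j = i" by (meson linear)
  moreover have "m = (if finite (UNIV :: int set) then enat (card (UNIV :: int set)) else \<infinity>)"
    using infinity by (simp add: infinite_UNIV_int)
  ultimately show ?thesis by blast
qed

text \<open>A quotient has no empty members, so each admissible pair must be realized for its
  spectral class to be an equivalence class. The infinite types leave room for countably many
  vertices and edges.\<close>

lemma spectral_class_nonempty:
  assumes "n \<ge> 1" "m \<ge> 1"
  shows "(spectral_class (n, m) :: ('v :: infinite, 'e :: infinite) graph_groupoid set) \<noteq> {}"
proof -
  obtain I :: "int set" and s where I: "I \<noteq> {}" "bij_betw s I I"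
      "\<And>i j. i \<in> I \<Longrightarrow> j \<in> I \<Longrightarrow> \<exists>k. (s ^^ k) i = j \<or> (s ^^ k) j = i"
      "m = (if finite I then enat (card I) else \<infinity>)"
    using ex_transitive_permutation[OF assms(2)] by blast
  obtain f :: "int \<Rightarrow> 'v" where f: "inj f" using ex_inj_infinite by blast
  obtain g :: "int \<times> nat \<Rightarrow> 'e" where g: "inj g" using ex_inj_infinite by blast
  note G = fractal_functional_graph[OF f g I(2) assms(1) I(1) I(3)]
  have "groupoid_of (functional_graph f g I s n) \<in> spectral_class (n, m)"
    using G I(4) by (auto simp: spectral_class_def fractaloids_def fractal_pair_groupoid_of)
  then show ?thesis by blast
qed

lemma fractal_pair_ge_1:
  assumes "\<G> \<in> fractaloids"
  shows "fractal_pair \<G> \<in> {1..} \<times> {1..}"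
proof -
  from assms obtain G where G: "fractal_graph G" "\<G> = groupoid_of G"
    by (auto simp: fractaloids_def)
  then obtain N where N: "N \<ge> 1" "\<And>v. v \<in> verts G \<Longrightarrow> out_degree G v = N"
    by (auto simp: fractal_graph_def)
  \<comment> \<open>Connectedness excludes the null graph. This makes the set of out-degrees the
    singleton \<open>{N}\<close>, whose \<open>Max\<close> is \<open>N\<close>, and the vertex count
    positive.\<close>
  have ne: "verts G \<noteq> {}"
    using G(1) by (auto simp: fractal_graph_def connected_def strongly_connected_def)
  with N(2) have "out_degree G ` verts G = {N}" by auto
  with N(1) have "max_out_degree G \<ge> 1" by (simp add: max_out_degree_def)
  moreover have "vertex_count G \<ge> 1"
    using ne by (auto simp: vertex_count_def one_enat_def Suc_le_eq card_gt_0_iff)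
  ultimately show ?thesis using G by (simp add: fractal_pair_groupoid_of)
qed

theorem corollary5p1:
  shows "(fractaloids :: ('v :: infinite, 'e :: infinite) graph_groupoid set) =
           (\<Union>nm \<in> {1..} \<times> {1..}. spectral_class nm) \<and>
         disjoint_family_on (spectral_class :: nat \<times> enat \<Rightarrow> ('v, 'e) graph_groupoid set)
           ({1..} \<times> {1..}) \<and>
         equiv (fractaloids :: ('v, 'e) graph_groupoid set) spectral_relation \<and>
         (fractaloids :: ('v, 'e) graph_groupoid set) // spectral_relation =
           spectral_class ` ({1..} \<times> {1..})"
proof (intro conjI)
  let ?F = "fractaloids :: ('v, 'e) graph_groupoid set"
  show "?F = (\<Union>nm \<in> {1..} \<times> {1..}. spectral_class nm)"
    using fractal_pair_ge_1 unfolding spectral_class_def by blast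
  show "disjoint_family_on (spectral_class :: nat \<times> enat \<Rightarrow> ('v, 'e) graph_groupoid set)
      ({1..} \<times> {1..})"
    by (auto simp: disjoint_family_on_def spectral_class_def)
  show "equiv ?F spectral_relation"
    by (rule equivI) (auto simp: spectral_relation_def refl_on_def sym_def trans_def)
  \<comment> \<open>Equivalence classes are exactly the fibres of \<open>fractal_pair\<close> over
    attained values.\<close>
  have image: "spectral_relation `` {\<G>} = spectral_class (fractal_pair \<G>)" if "\<G> \<in> ?F" for \<G>
    using that by (auto simp: spectral_relation_def spectral_class_def)
  show "?F // spectral_relation = spectral_class ` ({1..} \<times> {1..})"
  proof (intro subset_antisym subsetI)
    fix C assume "C \<in> ?F // spectral_relation"
    then obtain \<G> where "\<G> \<in> ?F" "C = spectral_relation `` {\<G>}" by (rule quotientE)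
    then show "C \<in> spectral_class ` ({1..} \<times> {1..})" using image fractal_pair_ge_1 by blast
  next
    fix C :: "('v, 'e) graph_groupoid set"
    assume "C \<in> spectral_class ` ({1..} \<times> {1..})"
    then obtain n m where "n \<ge> 1" "m \<ge> 1" and C: "C = spectral_class (n, m)" by auto
    \<comment> \<open>Any member of the class represents it in the quotient.\<close>
    then obtain \<G> where "\<G> \<in> C" using spectral_class_nonempty by blast
    with C have "\<G> \<in> ?F" "C = spectral_relation `` {\<G>}"
      using image by (auto simp: spectral_class_def)
    then show "C \<in> ?F // spectral_relation" by (simp add: quotientI)
  qed
qed

end
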